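(* Let $\mathcal{X}$ be an $N$-order tensor with all mode lengths equal to $I$ and with set of observable entries $\Omega$, and let the core tensor have all mode lengths equal to $J$. Then the memory complexity of the P-Tucker-Approx algorithm, i.e. the space required for its intermediate data, is $O(J^N)$.
   Context: Memory complexity refers to intermediate data: the working memory of the algorithm, excluding the memory for storing the input tensor $\mathcal{X}$, the core tensor $\mathcal{G}$ and the factor matrices $\mathbf{A}^{(n)}$ themselves. Data: tensor $\mathcal{X}$ with observable index tuples $\Omega\subseteq\{1,\dots,I\}^N$, factor matrices $\mathbf{A}^{(n)}=(a^{(n)}_{ij})\in\mathbb{R}^{I\times J}$ ($n=1,\dots,N$), core tensor $\mathcal{G}\in\mathbb{R}^{J\times\cdots\times J}$ of order $N$ (so at most $J^N$ entries), regularization parameter $\lambda>0$, truncation rate $p\in(0,1)$. "$\beta\in\mathcal{G}$" means that $\beta$ ranges over the index tuples of the remaining entries of $\mathcal{G}$. $\Omega^{(n)}_{i_n}$ is the set of tuples in $\Omega$ with $n$th coordinate $i_n$. One iteration of P-Tucker-Approx: (1) Updating factor matrices. For each $n=1,\dots,N$ and each row $i_n=1,\dots,I$ (per-row data is released after each row update): for each $\alpha=(i_1,\dots,i_N)\in\Omega^{(n)}_{i_n}$, compute $\delta^{(n)}_\alpha\in\mathbb{R}^J$ by looping over all $\beta=(j_1,\dots,j_N)\in\mathcal{G}$ and adding $\mathcal{G}_\beta\prod_{k\ne n}a^{(k)}_{i_kj_k}$ to $\delta^{(n)}_\alpha(j_n)$; accumulate $\mathbf{B}^{(n)}_{i_n}\in\mathbb{R}^{J\times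 J}$, with entries $\sum_{\alpha\in\Omega^{(n)}_{i_n}}\delta^{(n)}_\alpha(j)\delta^{(n)}_\alpha(j')$, and $\mathbf{c}^{(n)}_{i_n:}\in\mathbb{R}^J$, with entries $\sum_{\alpha\in\Omega^{(n)}_{i_n}}\mathcal{X}_\alpha\delta^{(n)}_\alpha(j)$; replace the $i_n$th row of $\mathbf{A}^{(n)}$ by $\mathbf{c}^{(n)}_{i_n:}[\mathbf{B}^{(n)}_{i_n}+\lambda\mathbf{I}_J]^{-1}$. (2) Compute the reconstruction error $\Bigl(\sum_{(i_1,\dots,i_N)\in\Omega}\bigl(\mathcal{X}_{(i_1,\dots,i_N)}-\sum_{(j_1,\dots,j_N)\in\mathcal{G}}\mathcal{G}_{(j_1,\dots,j_N)}\prod_{n=1}^N a^{(n)}_{i_nj_n}\bigr)^2\Bigr)^{1/2}$. (3) Truncation. For $\alpha=(i_1,\dots,i_N)\in\Omega$ and $\gamma=(j_1,\dots,j_N)\in\mathcal{G}$ write $P_{\alpha,\gamma}=\mathcal{G}_\gamma\prod_{n=1}^N a^{(n)}_{i_nj_n}$. For each $\beta\in\mathcal{G}$ compute and store the partial reconstruction error $$\mathcal{R}(\beta)=\sum_{\alpha\in\Omega}P_{\alpha,\beta}\Bigl(-2\mathcal{X}_\alpha+P_{\alpha,\beta}+2\sum_{\gamma\ne\beta}P_{\alpha,\gamma}\Bigr),$$ sort the values $\mathcal{R}(\beta)$ in descending order together with their indices, and remove from $\mathcal{G}$ the $p|\mathcal{G}|$ entries with the largest values of $\mathcal{R}$, where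 $|\mathcal{G}|$ is the current number of entries of $\mathcal{G}$.
   Formalization: The order is assumed to satisfy N ≥ 2 (and I, J ≥ 1): for N = 1 the J×J matrix B of the row update alone occupies J² words, so the bound O(J^N) = O(J) fails. *)

theory Defs
  imports Complex_Main
begin

text \<open>
  P-Tucker-Approx is written as a program of a small imperative language over a real RAM whose
  semantics records the largest number of memory words that are ever in use simultaneously.
  One word holds one number; an index is stored as an integer-valued word.  Coordinates
  and positions are counted from 0.

  The machine has three kinds of storage.  The problem instance is read-only.  The core tensor and
  the factor matrices may be read and overwritten in place.  Neither of these is charged.
  Everything else (arrays, scalars, loop counters, operands of expressions) lives in the working
  memory, which is charged.
\<close>

record problem =
  order :: nat                        \<comment> \<open>\<open>N\<close>\<close>
  dim :: nat                          \<comment> \<open>\<open>I\<close>\<close>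
  rank :: nat                         \<comment> \<open>\<open>J\<close>\<close>
  regularization :: real              \<comment> \<open>\<open>\<lambda>\<close>\<close>
  rate :: real                        \<comment> \<open>\<open>p\<close>\<close>
  observed :: "nat list list"         \<comment> \<open>the tuples of \<open>\<Omega>\<close>, each listed once\<close>
  tensor :: "nat list \<Rightarrow> real"        \<comment> \<open>\<open>\<X>\<close>, only read at observed tuples\<close>

type_synonym core_tensor = "(nat list \<times> real) list"   \<comment> \<open>remaining entries, with their indices\<close>
type_synonym factors = "nat \<Rightarrow> nat \<Rightarrow> nat \<Rightarrow> real"    \<comment> \<open>mode, row, column\<close>

definition index_tuples :: "nat \<Rightarrow> nat \<Rightarrow> nat list set" where
  "index_tuples N d = {xs. length xs = N \<and> set xs \<subseteq> {..<d}}"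


subsection \<open>Working memory\<close>

text \<open>A stack of named blocks of words; an inner block shadows an outer one of the same name,
  but both are charged.\<close>

type_synonym memory = "(string \<times> real list) list"

definition space :: "memory \<Rightarrow> nat" where
  "space m = (\<Sum>(x, v)\<leftarrow>m. length v)"

definition load :: "memory \<Rightarrow> string \<Rightarrow> nat \<Rightarrow> real" where
  "load m x k = (case map_of m x of Some v \<Rightarrow> if k < length v then v ! k else 0 | None \<Rightarrow> 0)"

text \<open>Writing never creates or enlarges a block: a write to an undeclared name or beyond the end of
  a block has no effect.\<close>

fun store :: "string \<Rightarrow> nat \<Rightarrow> real \<Rightarrow> memory \<Rightarrow> memory" where
  "store x k r [] = []"
| "store x k r ((y, v) # m) = (if x = y then (y, v[k := r]) # m else (y, v) # store x k r m)"

record state =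
  core :: core_tensor
  factor :: factors
  mem :: memory
  peak :: nat       \<comment> \<open>high-water mark of the working memory; does not influence the computation\<close>

definition charge :: "nat \<Rightarrow> state \<Rightarrow> state" where
  "charge k s = s\<lparr>peak := max (peak s) (space (mem s) + k)\<rparr>"

definition push :: "string \<Rightarrow> real list \<Rightarrow> state \<Rightarrow> state" where
  "push x v s = charge 0 (s\<lparr>mem := (x, v) # mem s\<rparr>)"

definition pop :: "state \<Rightarrow> state" where
  "pop s = s\<lparr>mem := tl (mem s)\<rparr>"


subsection \<open>Expressions\<close>

datatype exp =
    Num real
  | Order | Dim | Rank | Lam | Rate
  | NumObs                       \<comment> \<open>\<open>|\<Omega>|\<close>\<close>
  | ObsIdx exp exp               \<comment> \<open>\<open>ObsIdx a k\<close>: coordinate \<open>k\<close> of the observed tuple at position \<open>a\<close>\<close>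
  | ObsVal exp                   \<comment> \<open>value of \<open>\<X>\<close> there\<close>
  | NumCore                      \<comment> \<open>current \<open>|\<G>|\<close>\<close>
  | CoreIdx exp exp              \<comment> \<open>\<open>CoreIdx b k\<close>: coordinate \<open>k\<close> of the core entry at position \<open>b\<close>\<close>
  | CoreVal exp
  | Fac exp exp exp
  | Load string exp
  | Plus exp exp (infixl "\<oplus>" 65)
  | Minus exp exp (infixl "\<ominus>" 65)
  | Times exp exp (infixl "\<otimes>" 70)
  | Divide exp exp (infixl "\<oslash>" 70)
  | Sqrt exp

datatype test = Less exp exp | Eq exp exp

definition as_index :: "real \<Rightarrow> nat" where
  "as_index r = nat \<lfloor>r\<rfloor>"

primrec eval :: "problem \<Rightarrow> exp \<Rightarrow> state \<Rightarrow> real" where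
  "eval P (Num r) s = r"
| "eval P Order s = real (order P)"
| "eval P Dim s = real (dim P)"
| "eval P Rank s = real (rank P)"
| "eval P Lam s = regularization P"
| "eval P Rate s = rate P"
| "eval P NumObs s = real (length (observed P))"
| "eval P (ObsIdx a k) s = real (observed P ! as_index (eval P a s) ! as_index (eval P k s))"
| "eval P (ObsVal a) s = tensor P (observed P ! as_index (eval P a s))"
| "eval P NumCore s = real (length (core s))"
| "eval P (CoreIdx b k) s = real (fst (core s ! as_index (eval P b s)) ! as_index (eval P k s))"
| "eval P (CoreVal b) s = snd (core s ! as_index (eval P b s))"
| "eval P (Fac n i j) s =
     factor s (as_index (eval P n s)) (as_index (eval P i s)) (as_index (eval P j s))"
| "eval P (Load x e) s = load (mem s) x (as_index (eval P e s))"
| "eval P (d \<oplus> e) s = eval P d s + eval P e s"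
| "eval P (d \<ominus> e) s = eval P d s - eval P e s"
| "eval P (d \<otimes> e) s = eval P d s * eval P e s"
| "eval P (d \<oslash> e) s = eval P d s / eval P e s"
| "eval P (Sqrt e) s = sqrt (eval P e s)"

primrec holds :: "problem \<Rightarrow> test \<Rightarrow> state \<Rightarrow> bool" where
  "holds P (Less d e) s \<longleftrightarrow> eval P d s < eval P e s"
| "holds P (Eq d e) s \<longleftrightarrow> eval P d s = eval P e s"

text \<open>Temporary words charged for evaluating an expression: one for the value of each
  subexpression.\<close>

primrec temps :: "exp \<Rightarrow> nat" where
  "temps (Num r) = 1"
| "temps Order = 1"
| "temps Dim = 1"
| "temps Rank = 1"
| "temps Lam = 1"
| "temps Rate = 1"
| "temps NumObs = 1"
| "temps (ObsIdx a k) = temps a + temps k + 1"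
| "temps (ObsVal a) = temps a + 1"
| "temps NumCore = 1"
| "temps (CoreIdx b k) = temps b + temps k + 1"
| "temps (CoreVal b) = temps b + 1"
| "temps (Fac n i j) = temps n + temps i + temps j + 1"
| "temps (Load x e) = temps e + 1"
| "temps (d \<oplus> e) = temps d + temps e + 1"
| "temps (d \<ominus> e) = temps d + temps e + 1"
| "temps (d \<otimes> e) = temps d + temps e + 1"
| "temps (d \<oslash> e) = temps d + temps e + 1"
| "temps (Sqrt e) = temps e + 1"

primrec test_temps :: "test \<Rightarrow> nat" where
  "test_temps (Less d e) = temps d + temps e + 1"
| "test_temps (Eq d e) = temps d + temps e + 1"


subsection \<open>Commands\<close>

datatype com =
    Skip
  | Seq com com (infixr ";;" 60)
  | Store string exp exp         \<comment> \<open>\<open>Store x e d\<close>: \<open>x[e] := d\<close>\<close>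
  | Cond test com com
  | For string exp com           \<comment> \<open>\<open>For x e c\<close>: run \<open>c\<close> with \<open>x = 0, 1, \<dots>, \<lfloor>e\<rfloor> - 1\<close>\<close>
  | Local string exp com         \<comment> \<open>\<open>Local x e c\<close>: run \<open>c\<close> with a block \<open>x\<close> of \<open>\<lfloor>e\<rfloor>\<close> zeros, then release it\<close>
  | SetFac exp exp exp exp       \<comment> \<open>\<open>SetFac n i j d\<close>: overwrite entry \<open>(i, j)\<close> of factor matrix \<open>n\<close>\<close>
  | CoreCopy exp exp             \<comment> \<open>\<open>CoreCopy e d\<close>: overwrite core entry \<open>e\<close> by core entry \<open>d\<close>\<close>
  | CoreTrunc exp                \<comment> \<open>keep only the first \<open>\<lfloor>e\<rfloor>\<close> core entries\<close>

text \<open>A loop occupies two words while it runs, for its counter and for its bound, which is evaluated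
  once.\<close>

primrec exec :: "problem \<Rightarrow> com \<Rightarrow> state \<Rightarrow> state" where
  "exec P Skip s = s"
| "exec P (c ;; d) s = exec P d (exec P c s)"
| "exec P (Store x e d) s =
     charge (temps e + temps d) s
       \<lparr>mem := store x (as_index (eval P e s)) (eval P d s) (mem s)\<rparr>"
| "exec P (Cond b c d) s =
     (let s' = charge (test_temps b) s in if holds P b s then exec P c s' else exec P d s')"
| "exec P (For x e c) s =
     (let n = as_index (eval P e s) in
      pop (fold (\<lambda>i t. exec P c (t\<lparr>mem := store x 0 (real i) (mem t)\<rparr>)) [0..<n]
             (push x [0, real n] (charge (temps e) s))))"
| "exec P (Local x e c) s =
     pop (exec P c (push x (replicate (as_index (eval P e s)) 0) (charge (temps e) s)))"
| "exec P (SetFac n i j d) s =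
     charge (temps n + temps i + temps j + temps d) s
       \<lparr>factor := (\<lambda>n' i' j'.
          if n' = as_index (eval P n s) \<and> i' = as_index (eval P i s) \<and> j' = as_index (eval P j s)
          then eval P d s else factor s n' i' j')\<rparr>"
| "exec P (CoreCopy e d) s =
     charge (temps e + temps d) s
       \<lparr>core := (core s)[as_index (eval P e s) := core s ! as_index (eval P d s)]\<rparr>"
| "exec P (CoreTrunc e) s =
     charge (temps e) s\<lparr>core := take (as_index (eval P e s)) (core s)\<rparr>"

text \<open>A scalar is a block of one word.\<close>

abbreviation Var :: "string \<Rightarrow> exp" where
  "Var x \<equiv> Load x (Num 0)"

abbreviation Assign :: "string \<Rightarrow> exp \<Rightarrow> com" (infix "::=" 61) where
  "x ::= e \<equiv> Store x (Num 0) e"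

abbreviation Scalar :: "string \<Rightarrow> com \<Rightarrow> com" where
  "Scalar x c \<equiv> Local x (Num 1) c"

abbreviation Array_Add :: "string \<Rightarrow> exp \<Rightarrow> exp \<Rightarrow> com" where
  "Array_Add x e d \<equiv> Store x e (Load x e \<oplus> d)"


subsection \<open>Updating the factor matrices\<close>

text \<open>\<open>\<delta>\<close> for the observed tuple at position \<open>a\<close> and mode \<open>n\<close>.\<close>

definition compute_delta :: com where
  "compute_delta =
     For ''j'' Rank (Store ''delta'' (Var ''j'') (Num 0)) ;;
     For ''b'' NumCore (Scalar ''prod''
       (''prod'' ::= CoreVal (Var ''b'') ;;
        For ''k'' Order
          (Cond (Eq (Var ''k'') (Var ''n'')) Skip
             (''prod'' ::= Var ''prod''
                \<otimes> Fac (Var ''k'') (ObsIdx (Var ''a'') (Var ''k'')) (CoreIdx (Var ''b'') (Var ''k'')))) ;;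
        Array_Add ''delta'' (CoreIdx (Var ''b'') (Var ''n'')) (Var ''prod'')))"

text \<open>The \<open>J \<times> J\<close> matrix \<open>B\<close> is stored row by row in one block.\<close>

definition B_pos :: "exp \<Rightarrow> exp \<Rightarrow> exp" where
  "B_pos j l = j \<otimes> Rank \<oplus> l"

definition accumulate_B_c :: com where
  "accumulate_B_c =
     For ''j'' Rank
       (For ''l'' Rank
          (Array_Add ''B'' (B_pos (Var ''j'') (Var ''l''))
             (Load ''delta'' (Var ''j'') \<otimes> Load ''delta'' (Var ''l''))) ;;
        Array_Add ''c'' (Var ''j'') (ObsVal (Var ''a'') \<otimes> Load ''delta'' (Var ''j'')))"

definition add_regularization :: com where
  "add_regularization =
     For ''j'' Rank (Array_Add ''B'' (B_pos (Var ''j'') (Var ''j'')) Lam)"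

text \<open>Gauss-Jordan inversion in place.  No pivot search is needed: the matrix is the sum of a Gram
  matrix and \<open>\<lambda> I\<close>, hence positive definite, so that all pivots are positive.\<close>

definition invert_B :: com where
  "invert_B =
     For ''k'' Rank (Scalar ''pivot''
       (''pivot'' ::= Load ''B'' (B_pos (Var ''k'') (Var ''k'')) ;;
        Store ''B'' (B_pos (Var ''k'') (Var ''k'')) (Num 1) ;;
        For ''l'' Rank
          (Store ''B'' (B_pos (Var ''k'') (Var ''l''))
             (Load ''B'' (B_pos (Var ''k'') (Var ''l'')) \<oslash> Var ''pivot'')) ;;
        For ''j'' Rank
          (Cond (Eq (Var ''j'') (Var ''k'')) Skip
             (Scalar ''f''
               (''f'' ::= Load ''B'' (B_pos (Var ''j'') (Var ''k'')) ;;
                Store ''B'' (B_pos (Var ''j'') (Var ''k'')) (Num 0) ;;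
                For ''l'' Rank
                  (Store ''B'' (B_pos (Var ''j'') (Var ''l''))
                     (Load ''B'' (B_pos (Var ''j'') (Var ''l''))
                        \<ominus> Var ''f'' \<otimes> Load ''B'' (B_pos (Var ''k'') (Var ''l'')))))))))"

definition replace_row :: com where
  "replace_row =
     For ''j'' Rank (Scalar ''sum''
       (For ''l'' Rank
          (''sum'' ::= Var ''sum''
             \<oplus> Load ''c'' (Var ''l'') \<otimes> Load ''B'' (B_pos (Var ''l'') (Var ''j''))) ;;
        SetFac (Var ''n'') (Var ''i'') (Var ''j'') (Var ''sum'')))"

definition update_row :: com where
  "update_row =
     Local ''delta'' Rank (Local ''B'' (Rank \<otimes> Rank) (Local ''c'' Rank
       (For ''a'' NumObs
          (Cond (Eq (ObsIdx (Var ''a'') (Var ''n'')) (Var ''i''))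
             (compute_delta ;; accumulate_B_c) Skip) ;;
        add_regularization ;;
        invert_B ;;
        replace_row)))"

definition update_factors :: com where
  "update_factors = For ''n'' Order (For ''i'' Dim update_row)"


subsection \<open>Reconstruction error\<close>

text \<open>\<open>P\<^bsub>\<alpha>,\<gamma>\<^esub>\<close> for the observed tuple at position \<open>a\<close> and the core entry at position \<open>g\<close>.\<close>

definition compute_product :: "string \<Rightarrow> exp \<Rightarrow> exp \<Rightarrow> com" where
  "compute_product x a g =
     x ::= CoreVal g ;;
     For ''k'' Order
       (x ::= Var x \<otimes> Fac (Var ''k'') (ObsIdx a (Var ''k'')) (CoreIdx g (Var ''k'')))"

definition reconstruction_error :: com where
  "reconstruction_error =
     ''error'' ::= Num 0 ;;
     For ''a'' NumObs (Scalar ''residual''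
       (''residual'' ::= ObsVal (Var ''a'') ;;
        For ''b'' NumCore (Scalar ''prod''
          (compute_product ''prod'' (Var ''a'') (Var ''b'') ;;
           ''residual'' ::= Var ''residual'' \<ominus> Var ''prod'')) ;;
        ''error'' ::= Var ''error'' \<oplus> Var ''residual'' \<otimes> Var ''residual'')) ;;
     ''error'' ::= Sqrt (Var ''error'')"


subsection \<open>Truncation\<close>

definition partial_errors :: com where
  "partial_errors =
     For ''b'' NumCore (For ''a'' NumObs (Scalar ''own'' (Scalar ''others''
       (compute_product ''own'' (Var ''a'') (Var ''b'') ;;
        For ''g'' NumCore
          (Cond (Eq (Var ''g'') (Var ''b'')) Skip
             (Scalar ''prod''
               (compute_product ''prod'' (Var ''a'') (Var ''g'') ;;
                ''others'' ::= Var ''others'' \<oplus> Var ''prod''))) ;;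
        Array_Add ''R'' (Var ''b'')
          (Var ''own'' \<otimes> (Num (-2) \<otimes> ObsVal (Var ''a'') \<oplus> Var ''own'' \<oplus> Num 2 \<otimes> Var ''others''))))))"

text \<open>Each value of \<open>R\<close> is accompanied by the position of its core entry in the list of remaining
  entries.\<close>

definition init_positions :: com where
  "init_positions = For ''b'' NumCore (Store ''pos'' (Var ''b'') (Var ''b''))"

definition swap_entries :: "string \<Rightarrow> exp \<Rightarrow> exp \<Rightarrow> com" where
  "swap_entries x e d =
     Scalar ''tmp''
       (''tmp'' ::= Load x e ;; Store x e (Load x d) ;; Store x d (Var ''tmp''))"

definition sort_descending :: com where
  "sort_descending =
     For ''u'' NumCore (For ''v'' NumCore
       (Cond (Less (Var ''u'') (Var ''v''))
          (Cond (Less (Load ''R'' (Var ''u'')) (Load ''R'' (Var ''v'')))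
             (swap_entries ''R'' (Var ''u'') (Var ''v'') ;;
              swap_entries ''pos'' (Var ''u'') (Var ''v''))
             Skip)
          Skip))"

text \<open>Flags the \<open>\<lfloor>p |\<G>|\<rfloor>\<close> entries with the largest values and closes the gaps they leave.\<close>

definition remove_entries :: com where
  "remove_entries =
     Local ''removed'' NumCore
       (For ''t'' (Rate \<otimes> NumCore) (Store ''removed'' (Load ''pos'' (Var ''t'')) (Num 1)) ;;
        Scalar ''kept''
          (For ''b'' NumCore
             (Cond (Eq (Load ''removed'' (Var ''b'')) (Num 0))
                (CoreCopy (Var ''kept'') (Var ''b'') ;;
                 ''kept'' ::= Var ''kept'' \<oplus> Num 1)
                Skip) ;;
           CoreTrunc (Var ''kept'')))"

definition truncate_core :: com where
  "truncate_core =
     Local ''R'' NumCore (Local ''pos'' NumCore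
       (partial_errors ;; init_positions ;; sort_descending ;; remove_entries))"


subsection \<open>The algorithm and its memory consumption\<close>

definition iteration :: com where
  "iteration = update_factors ;; reconstruction_error ;; truncate_core"

definition p_tucker_approx :: "nat \<Rightarrow> com" where
  "p_tucker_approx T = For ''iter'' (Num (real T)) iteration"

text \<open>The run starts with the single word that receives the reconstruction error.\<close>

definition initial_state :: "core_tensor \<Rightarrow> factors \<Rightarrow> state" where
  "initial_state G A = \<lparr>core = G, factor = A, mem = [(''error'', [0])], peak = 1\<rparr>"

definition memory_usage :: "problem \<Rightarrow> com \<Rightarrow> core_tensor \<Rightarrow> factors \<Rightarrow> nat" where
  "memory_usage P c G A = peak (exec P c (initial_state G A))"

end

theory Submission
  imports Defs
begin

text \<open>
  The program never enlarges the core tensor, which therefore keeps at most \<open>J\<^sup>N\<close> entries, and every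
  array or scalar that it declares has \<open>1\<close>, \<open>J\<close>, \<open>J\<^sup>2\<close> or \<open>|\<G>|\<close> words, hence at most \<open>J\<^sup>N\<close>
  because \<open>N \<ge> 2\<close>.  Blocks are released in the order opposite to their allocation, so the number
  of such blocks, loop words and temporary words in use at any moment is at most the number that
  occur in the program text, which does not depend on the instance.
\<close>

text \<open>Block lengths are kept as a list because \<open>pop\<close> drops the head block: the
  total alone would not determine the space left afterwards.\<close>

definition shape :: "memory \<Rightarrow> nat list" where
  "shape m = map (\<lambda>(x, v). length v) m"

lemma space_eq_sum_shape: "space m = sum_list (shape m)"
  by (simp add: space_def shape_def)

lemma shape_store [simp]: "shape (store x k r m) = shape m"
  by (induction m) (auto simp: shape_def)

text \<open>A loop body counts once, since each round releases what it allocates. Adding over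
  sequences and branches, where a maximum would do, is a harmless overestimate.\<close>

primrec block_count :: "com \<Rightarrow> nat" where
  "block_count Skip = 0"
| "block_count (c ;; d) = block_count c + block_count d"
| "block_count (Store x e d) = temps e + temps d"
| "block_count (Cond b c d) = test_temps b + block_count c + block_count d"
| "block_count (For x e c) = temps e + 2 + block_count c"
| "block_count (Local x e c) = temps e + 1 + block_count c"
| "block_count (SetFac n i j d) = temps n + temps i + temps j + temps d"
| "block_count (CoreCopy e d) = temps e + temps d"
| "block_count (CoreTrunc e) = temps e"

text \<open>Quantifying over all states with a small core, reachable or not, makes this a check of
  the program text.\<close>

primrec blocks_bounded :: "problem \<Rightarrow> nat \<Rightarrow> com \<Rightarrow> bool" where
  "blocks_bounded P W Skip \<longleftrightarrow> True"
| "blocks_bounded P W (c ;; d) \<longleftrightarrow> blocks_bounded P W c \<and> blocks_bounded P W d"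
| "blocks_bounded P W (Store x e d) \<longleftrightarrow> True"
| "blocks_bounded P W (Cond b c d) \<longleftrightarrow> blocks_bounded P W c \<and> blocks_bounded P W d"
| "blocks_bounded P W (For x e c) \<longleftrightarrow> blocks_bounded P W c"
| "blocks_bounded P W (Local x e c) \<longleftrightarrow>
     (\<forall>s. length (core s) \<le> W \<longrightarrow> as_index (eval P e s) \<le> W) \<and> blocks_bounded P W c"
| "blocks_bounded P W (SetFac n i j d) \<longleftrightarrow> True"
| "blocks_bounded P W (CoreCopy e d) \<longleftrightarrow> True"
| "blocks_bounded P W (CoreTrunc e) \<longleftrightarrow> True"

definition bounded_step :: "nat \<Rightarrow> nat \<Rightarrow> state \<Rightarrow> state \<Rightarrow> bool" where
  "bounded_step W k s t \<longleftrightarrow> length (core t) \<le> W \<and> shape (mem t) = shape (mem s) \<and>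
     peak t \<le> max (peak s) (space (mem s) + k)"

text \<open>The allowance \<open>k\<close> does not add up: equal shapes give both steps the same
  base space, and \<open>max\<close> is idempotent.\<close>

lemma bounded_step_trans: "bounded_step W k s t \<Longrightarrow> bounded_step W k t u \<Longrightarrow> bounded_step W k s u"
  by (auto simp: bounded_step_def space_eq_sum_shape)

lemma bounded_step_mono: "bounded_step W k s t \<Longrightarrow> k \<le> l \<Longrightarrow> bounded_step W l s t"
  by (auto simp: bounded_step_def)

lemma bounded_step_charge: "length (core s) \<le> W \<Longrightarrow> k \<le> l \<Longrightarrow> bounded_step W l s (charge k s)"
  by (auto simp: bounded_step_def charge_def)

lemma core_charge [simp]: "core (charge k s) = core s"
  by (simp add: charge_def)

lemma mem_charge [simp]: "mem (charge k s) = mem s"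
  by (simp add: charge_def)

lemma core_push [simp]: "core (push x v s) = core s"
  by (simp add: push_def)

text \<open>The body restores the shape, so \<open>pop\<close> releases exactly the pushed block,
  whose length joins the allowance.\<close>

lemma bounded_step_pop_push:
  assumes "bounded_step W k (push x v s) t"
  shows "bounded_step W (length v + k) s (pop t)"
  using assms
  by (auto simp: bounded_step_def push_def pop_def charge_def space_eq_sum_shape map_tl shape_def)

text \<open>By transitivity at fixed \<open>k\<close>, the number of rounds is irrelevant; hence
  \<open>T\<close>, \<open>I\<close> and the number of observed tuples do not enter the
  bound.\<close>

lemma bounded_step_fold:
  assumes "length (core s) \<le> W"
    and "\<And>i t. length (core t) \<le> W \<Longrightarrow> bounded_step W k t (f i t)"
  shows "bounded_step W k s (fold f is s)"
  using assms(1)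
proof (induction "is" arbitrary: s)
  case Nil
  then show ?case by (simp add: bounded_step_def)
next
  case (Cons i "is")
  then have "bounded_step W k s (f i s)" by (intro assms(2))
  moreover from this have "length (core (f i s)) \<le> W" by (simp add: bounded_step_def)
  then have "bounded_step W k (f i s) (fold f is (f i s))" by (rule Cons.IH)
  ultimately show ?case by (auto intro: bounded_step_trans)
qed

text \<open>Each counted item is a single word or a block of at most \<open>W\<close> words, and
  \<open>W \<ge> 1\<close> covers both cases. The core stays short because commands only overwrite
  its entries or take a prefix.\<close>

lemma bounded_step_exec:
  assumes "blocks_bounded P W c" "W \<ge> 1" "length (core s) \<le> W"
  shows "bounded_step W (block_count c * W) s (exec P c s)"
  using assms(1,3)
proof (induction c arbitrary: s)
  case Skip
  then show ?case by (simp add: bounded_step_def)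
next
  case (Seq c d)
  then have c: "bounded_step W (block_count c * W) s (exec P c s)" by simp
  then have "bounded_step W (block_count d * W) (exec P c s) (exec P d (exec P c s))"
    using Seq by (simp add: bounded_step_def)
  with c show ?case
    by (auto intro!: bounded_step_trans[of _ _ s "exec P c s"] elim!: bounded_step_mono)
next
  case (Store x e d)
  have "bounded_step W ((temps e + temps d) * W) s (charge (temps e + temps d) s)"
    using Store.prems \<open>W \<ge> 1\<close> by (intro bounded_step_charge) auto
  then show ?case by (auto simp: bounded_step_def)
next
  case (Cond b c d)
  let ?s = "charge (test_temps b) s" and ?k = "block_count (Cond b c d) * W"
  have "test_temps b \<le> test_temps b * W" using \<open>W \<ge> 1\<close> by simp
  also have "\<dots> \<le> ?k" by (simp add: algebra_simps)
  finally have s: "bounded_step W ?k s ?s" using Cond.prems by (intro bounded_step_charge) auto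
  have "bounded_step W (block_count c * W) ?s (exec P c ?s)"
    "bounded_step W (block_count d * W) ?s (exec P d ?s)" using Cond by auto
  then have "bounded_step W ?k ?s (exec P c ?s)" "bounded_step W ?k ?s (exec P d ?s)"
    by (auto elim!: bounded_step_mono)
  then show ?case using bounded_step_trans[OF s] by (auto simp: Let_def)
next
  case (For x e c)
  let ?s = "charge (temps e) s" and ?k = "block_count c * W"
  let ?f = "\<lambda>i t. exec P c (t\<lparr>mem := store x 0 (real i) (mem t)\<rparr>)"
  define n where "n = as_index (eval P e s)"
  \<comment> \<open>Writing the counter preserves shape, core and peak, so the induction hypothesis
    transfers from the updated state to \<open>t\<close>.\<close>
  have "bounded_step W ?k t (?f i t)" if "length (core t) \<le> W" for i t
    using For.IH[of "t\<lparr>mem := store x 0 (real i) (mem t)\<rparr>"] For.prems that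
    by (simp add: bounded_step_def space_eq_sum_shape)
  then have "bounded_step W ?k (push x [0, real n] ?s) (fold ?f [0..<n] (push x [0, real n] ?s))"
    using For.prems by (intro bounded_step_fold) auto
  \<comment> \<open>The 2 is the counter together with the stored bound.\<close>
  from bounded_step_pop_push[OF this]
  have body: "bounded_step W (2 + ?k) ?s (exec P (For x e c) s)" by (simp add: Let_def n_def)
  have "temps e + 2 \<le> (temps e + 2) * W"
    using mult_le_mono2[OF \<open>W \<ge> 1\<close>, of "temps e + 2"] by simp
  then have k: "temps e + 2 + ?k \<le> block_count (For x e c) * W" by (simp add: algebra_simps)
  have "bounded_step W (block_count (For x e c) * W) s ?s"
    using For.prems k by (intro bounded_step_charge) auto
  moreover have "bounded_step W (block_count (For x e c) * W) ?s (exec P (For x e c) s)"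
    using body by (rule bounded_step_mono) (use k in linarith)
  ultimately show ?case by (rule bounded_step_trans)
next
  case (Local x e c)
  let ?s = "charge (temps e) s" and ?k = "block_count c * W"
  define n where "n = as_index (eval P e s)"
  \<comment> \<open>Here the size condition of \<open>blocks_bounded\<close> is instantiated at the
    current state.\<close>
  have "n \<le> W" using Local.prems by (simp add: n_def)
  have "bounded_step W ?k (push x (replicate n 0) ?s) (exec P c (push x (replicate n 0) ?s))"
    using Local by simp
  from bounded_step_pop_push[OF this]
  have body: "bounded_step W (n + ?k) ?s (exec P (Local x e c) s)" by (simp add: n_def)
  have "temps e \<le> temps e * W" using \<open>W \<ge> 1\<close> by simp
  then have "temps e + n + ?k \<le> temps e * W + W + ?k" using \<open>n \<le> W\<close> by linarith
  also have "\<dots> = block_count (Local x e c) * W" by (simp add: algebra_simps)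
  finally have k: "temps e + n + ?k \<le> block_count (Local x e c) * W" .
  have "bounded_step W (block_count (Local x e c) * W) s ?s"
    using Local.prems k by (intro bounded_step_charge) auto
  moreover have "bounded_step W (block_count (Local x e c) * W) ?s (exec P (Local x e c) s)"
    using body by (rule bounded_step_mono) (use k in linarith)
  ultimately show ?case by (rule bounded_step_trans)
next
  case (SetFac n i j d)
  have "bounded_step W ((temps n + temps i + temps j + temps d) * W) s
      (charge (temps n + temps i + temps j + temps d) s)"
    using SetFac.prems \<open>W \<ge> 1\<close> by (intro bounded_step_charge) auto
  then show ?case by (auto simp: bounded_step_def)
next
  case (CoreCopy e d)
  have "bounded_step W ((temps e + temps d) * W) s (charge (temps e + temps d) s)"
    using CoreCopy.prems \<open>W \<ge> 1\<close> by (intro bounded_step_charge) auto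
  then show ?case by (auto simp: bounded_step_def)
next
  case (CoreTrunc e)
  have "bounded_step W (temps e * W) s (charge (temps e) s)"
    using CoreTrunc.prems \<open>W \<ge> 1\<close> by (intro bounded_step_charge) auto
  then show ?case by (auto simp: bounded_step_def)
qed

lemma as_index_of_nat [simp]: "as_index (real n) = n"
  by (simp add: as_index_def)

lemma as_index_one [simp]: "as_index 1 = 1"
  by (simp add: as_index_def)

lemma as_index_mult [simp]: "as_index (real m * real n) = m * n"
  by (metis as_index_of_nat of_nat_mult)

text \<open>Unfolding leaves one inequality per declared block; for blocks of \<open>NumCore\<close>
  words it is the premise on the core. \<open>Rate\<close> and \<open>T\<close> occur only in loop
  bounds, whose values cost no space.\<close>

lemma blocks_bounded_p_tucker_approx:
  assumes "1 \<le> W" "rank P \<le> W" "rank P * rank P \<le> W"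
  shows "blocks_bounded P W (p_tucker_approx T)"
  using assms
  by (simp add: p_tucker_approx_def iteration_def update_factors_def update_row_def
      compute_delta_def accumulate_B_c_def add_regularization_def invert_B_def replace_row_def
      reconstruction_error_def compute_product_def truncate_core_def partial_errors_def
      init_positions_def sort_descending_def swap_entries_def remove_entries_def)

text \<open>The outer loop costs one temporary for its bound and two loop words, whatever
  \<open>T\<close> is, so the constant can be chosen before \<open>T\<close>.\<close>

lemma block_count_p_tucker_approx:
  "block_count (p_tucker_approx T) = 3 + block_count iteration"
  by (simp add: p_tucker_approx_def)

lemma length_core_le:
  assumes "fst ` set G \<subseteq> index_tuples N J" "distinct (map fst G)"
  shows "length G \<le> J ^ N"
proof -
  \<comment> \<open>The conjuncts are reordered to match the library facts on lists of fixed
    length.\<close>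
  have tuples: "index_tuples N J = {xs. set xs \<subseteq> {..<J} \<and> length xs = N}"
    by (auto simp: index_tuples_def)
  have "length G = card (fst ` set G)"
    using distinct_card[OF assms(2)] by simp
  also have "\<dots> \<le> card (index_tuples N J)"
    using assms(1) by (intro card_mono) (simp_all add: tuples finite_lists_length_eq)
  finally show ?thesis by (simp add: tuples card_lists_length_eq)
qed

theorem theorem8:
  shows "\<exists>C::real. C > 0 \<and>
    (\<forall>(N::nat) (I::nat) (J::nat) (lam::real) (p::real)
      (Omega::nat list set) (obs::nat list list) (X::nat list \<Rightarrow> real)
      (G::core_tensor) (A::factors) (T::nat).
        N \<ge> 2 \<longrightarrow> I \<ge> 1 \<longrightarrow> J \<ge> 1 \<longrightarrow> lam > 0 \<longrightarrow> 0 < p \<longrightarrow> p < 1 \<longrightarrow>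
        Omega \<subseteq> index_tuples N I \<longrightarrow> set obs = Omega \<longrightarrow> distinct obs \<longrightarrow>
        fst ` set G \<subseteq> index_tuples N J \<longrightarrow> distinct (map fst G) \<longrightarrow>
        real (memory_usage
          \<lparr>order = N, dim = I, rank = J, regularization = lam, rate = p,
           observed = obs, tensor = X\<rparr>
          (p_tucker_approx T) G A)
        \<le> C * real J ^ N)"
\<comment> \<open>In the constant, 3 pays for the outer loop and 1 for the word \<open>error\<close>
  present at the start.\<close>
proof (intro exI[of _ "real (4 + block_count iteration)"] conjI allI impI)
  show "0 < real (4 + block_count iteration)" by simp
next
  fix N I J :: nat and lam p :: real and Omega :: "nat list set" and obs :: "nat list list"
    and X :: "nat list \<Rightarrow> real" and G :: core_tensor and A :: factors and T :: nat
  assume "N \<ge> 2" "J \<ge> 1"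
    and G: "fst ` set G \<subseteq> index_tuples N J" "distinct (map fst G)"
  let ?P = "\<lparr>order = N, dim = I, rank = J, regularization = lam, rate = p,
    observed = obs, tensor = X\<rparr>"
  let ?W = "J ^ N" and ?s = "initial_state G A"
  \<comment> \<open>The square is the size of the block \<open>B\<close>.\<close>
  have "J \<le> ?W" "J ^ 2 \<le> ?W" "1 \<le> ?W"
    using \<open>N \<ge> 2\<close> \<open>J \<ge> 1\<close> by (auto intro: self_le_power power_increasing)
  then have "blocks_bounded ?P ?W (p_tucker_approx T)"
    by (intro blocks_bounded_p_tucker_approx) (simp_all add: power2_eq_square)
  then have "bounded_step ?W (block_count (p_tucker_approx T) * ?W) ?s
      (exec ?P (p_tucker_approx T) ?s)"
    using \<open>1 \<le> ?W\<close> length_core_le[OF G]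
    by (intro bounded_step_exec) (simp_all add: initial_state_def)
  \<comment> \<open>Initial peak and initial space are both 1, so the maximum in
    \<open>bounded_step\<close> collapses to this sum.\<close>
  then have "memory_usage ?P (p_tucker_approx T) G A \<le> 1 + (3 + block_count iteration) * ?W"
    by (simp add: bounded_step_def memory_usage_def block_count_p_tucker_approx initial_state_def
        space_def)
  also have "\<dots> \<le> (4 + block_count iteration) * ?W"
    using \<open>1 \<le> ?W\<close> by (simp add: algebra_simps)
  finally show "real (memory_usage ?P (p_tucker_approx T) G A)
      \<le> real (4 + block_count iteration) * real J ^ N"
    by (metis of_nat_le_iff of_nat_mult of_nat_power)
qed

end
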